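(* Suppose that $E e^{u\eta_1}<\infty$ for all $0\le u<\infty$, that $$E\log(1+|\eta_1|)<\infty,$$ and that $$\int_1^\infty e^{uy-\phi(u)}u^{-1}\,du<\infty\quad\text{for every } y\in D.$$ If $E(\tau_a)<\infty$, then $$E\tau_a=\frac{1}{\log(1/\lambda)}\int_0^\infty\left(E e^{uX_{\tau_a}}-e^{ux}\right)e^{-\phi(u)}u^{-1}\,du .$$
   Context: Let $\{\eta_n\}_{n\ge 1}$ be a sequence of independent identically distributed real random variables, and let $\lambda$ and $x$ be nonrandom real constants with $0<\lambda<1$. The AR(1) sequence $(X_n)_{n\ge 0}$ is defined by $X_0=x$ and $X_n=\lambda X_{n-1}+\eta_n$ for $n=1,2,\dots$. The set $D\subset\mathbb{R}$ denotes the domain (state space) of the process, i.e. the set of values taken by $X_n$, $n=0,1,2,\dots$ (so $x\in D$ and $X_n\in D$ almost surely for all $n$). For a real number $a\ge x$, the first passage time is $\tau_a=\inf\{n\ge 0: X_n>a\}$, with $\inf\emptyset=\infty$. The cumulant function of $\eta_1$ is $\psi(u)=\log E e^{u\eta_1}$, $0\le u<\infty$, and $\phi(u)=\sum_{k=0}^\infty\psi(\lambda^k u)$, $0\le u<\infty$ (this series converges to a finite value when $E e^{u\eta_1}<\infty$ for all $u\ge0$ and $E\log(1+|\eta_1|)<\infty$). *)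

theory Defs
  imports "HOL-Probability.Probability"
begin

definition iid_seq :: "'a measure \<Rightarrow> (nat \<Rightarrow> 'a \<Rightarrow> real) \<Rightarrow> bool" where
  "iid_seq M \<eta> \<longleftrightarrow>
     prob_space.indep_vars M (\<lambda>_. borel) \<eta> {1..} \<and>
     (\<forall>n\<ge>1. distr M borel (\<eta> n) = distr M borel (\<eta> 1))"

(* The innovations are indexed from 1; the value of "\<eta> 0" is never used. *)
primrec ar1 :: "real \<Rightarrow> real \<Rightarrow> (nat \<Rightarrow> 'a \<Rightarrow> real) \<Rightarrow> nat \<Rightarrow> 'a \<Rightarrow> real" where
  "ar1 l x \<eta> 0 \<omega> = x"
| "ar1 l x \<eta> (Suc n) \<omega> = l * ar1 l x \<eta> n \<omega> + \<eta> (Suc n) \<omega>"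

(* The infimum is taken in enat, where Inf {} is \<infinity>. *)
definition first_passage :: "(nat \<Rightarrow> 'a \<Rightarrow> real) \<Rightarrow> real \<Rightarrow> 'a \<Rightarrow> enat" where
  "first_passage X a \<omega> = Inf {enat n | n. X n \<omega> > a}"

definition expected_time :: "'a measure \<Rightarrow> ('a \<Rightarrow> enat) \<Rightarrow> ennreal" where
  "expected_time M T = (\<integral>\<^sup>+ \<omega>. ennreal_of_enat (T \<omega>) \<partial>M)"

(* On the event that T is infinite this is a dummy value (the_enat \<infinity> is unspecified);
   it is only meaningful for an almost surely finite T. *)
definition value_at :: "(nat \<Rightarrow> 'a \<Rightarrow> real) \<Rightarrow> ('a \<Rightarrow> enat) \<Rightarrow> 'a \<Rightarrow> real" where
  "value_at X T \<omega> = X (the_enat (T \<omega>)) \<omega>"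

definition cumulant :: "'a measure \<Rightarrow> ('a \<Rightarrow> real) \<Rightarrow> real \<Rightarrow> real" where
  "cumulant M Y u = ln (\<integral>\<omega>. exp (u * Y \<omega>) \<partial>M)"

definition cumulant_series :: "'a measure \<Rightarrow> real \<Rightarrow> ('a \<Rightarrow> real) \<Rightarrow> real \<Rightarrow> real" where
  "cumulant_series M l Y u = (\<Sum>k. cumulant M Y (l ^ k * u))"

end

theory Submission imports Defs begin

text \<open>
  Write \<open>m u\<close> (\<open>mgf\<close> below) for the moment generating function of the innovations and \<open>\<rho> u = exp (- \<phi> u)\<close>.
  Since \<open>\<phi> u = \<psi> u + \<phi> (l * u)\<close>, one has \<open>\<rho> u * m u = \<rho> (l * u)\<close>.  Consider the moment
  generating function of the occupation measure of the process before the passage time (\<open>occ_mgf\<close>),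
  \<open>S u = (\<Sum>k. E (exp (u * X k); \<tau> > k))\<close>; in particular \<open>S 0 = E \<tau>\<close>.  Before the passage the
  process stays below \<open>a\<close>, so \<open>S u \<le> exp (u * a) * S 0\<close> is finite for \<open>u \<ge> 0\<close>.

  Splitting \<open>{\<tau> \<ge> k}\<close> into \<open>{\<tau> = k}\<close> and \<open>{\<tau> > k}\<close> and using that \<open>\<eta> (k + 1)\<close> is independent of the
  past, summation over \<open>k\<close> gives the balance identity
  \<open>E exp (u * X \<tau>) = exp (u * x) + m u * S (l * u) - S u\<close>
  (lemma \<open>exp_value_at_expectation\<close>); it takes the place of an optional stopping theorem.
  Multiplying by \<open>\<rho> u\<close> and putting \<open>A u = \<rho> u * S u\<close> (\<open>damped_mgf\<close>) turns the integrand of the theorem into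
  \<open>(A (l * u) - A u) / u\<close>, a Frullani integrand.  Its integral over \<open>{0<..}\<close> is
  \<open>A 0 * ln (1 / l) = E \<tau> * ln (1 / l)\<close>.

  Absolute integrability near \<open>0\<close> costs nothing, because \<open>X \<tau> > a \<ge> x\<close> makes the integrand nonnegative
  (lemma \<open>frullani_nonneg\<close>).  What remains is that \<open>A\<close> tends to \<open>E \<tau>\<close> at \<open>0\<close>, where the logarithmic
  moment enters through \<open>\<phi> u \<rightarrow> 0\<close>, and that \<open>A u / u\<close> is integrable away from \<open>0\<close>.  The latter
  follows from the integrability hypothesis at any single point \<open>y > a\<close> of the state space; there is
  one, as otherwise the passage time would be almost surely infinite.
\<close>

section \<open>Frullani integrals with nonnegative integrand\<close>

lemma integral_inverse_Icc:
  fixes l e :: real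
  assumes "0 < l" "l < 1" "0 < e"
  shows "has_bochner_integral lborel (\<lambda>v. indicator {l * e..e} v * (1 / v)) (ln (1 / l))"
proof -
  have pos: "0 < l * e" and le: "l * e \<le> e"
    using assms by (auto intro: mult_left_le_one_le)
  have "has_bochner_integral lborel (\<lambda>v. 1 / v * indicator {l * e..e} v) (ln e - ln (l * e))"
    using pos le by (intro has_bochner_integral_FTC_Icc_nonneg)
      (auto intro!: derivative_eq_intros)
  moreover have "ln e - ln (l * e) = ln (1 / l)"
    using assms by (simp add: ln_mult ln_div)
  ultimately show ?thesis by (simp add: mult.commute)
qed

text \<open>
  Over \<open>{e..}\<close> the substitution \<open>v = l * u\<close> moves the first half of the integrand to \<open>{l * e..}\<close>, so that
  the difference is an integral over the window \<open>{l * e..e}\<close>.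
\<close>
lemma truncated_frullani:
  fixes A :: "real \<Rightarrow> real"
  assumes l: "0 < l" "l < 1" and e: "0 < e"
    and int: "\<And>e. 0 < e \<Longrightarrow> integrable lborel (\<lambda>u. indicator {e..} u * (A u / u))"
  shows "has_bochner_integral lborel (\<lambda>u. indicator {e..} u * ((A (l * u) - A u) / u))
           (\<integral>v. indicator {l * e..e} v * (A v / v) \<partial>lborel)"
proof -
  let ?H = "\<lambda>u. A u / u"
  have le: "0 < l * e" "l * e \<le> e"
    using l e by (auto intro: mult_left_le_one_le)
  have eq: "indicator {l * e..} (0 + l * u) * ?H (0 + l * u) * l = indicator {e..} u * (A (l * u) / u)" for u
    using l by (auto simp: indicator_def field_simps)
  have "integrable lborel (\<lambda>u. indicator {l * e..} (0 + l * u) * ?H (0 + l * u) * l)"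
    using lborel_integrable_real_affine[OF int[OF le(1)], of l 0] l
    by (intro integrable_mult_left) simp
  then have int1: "integrable lborel (\<lambda>u. indicator {e..} u * (A (l * u) / u))"
    by (simp only: eq)
  have "(\<integral>v. indicator {l * e..} v * ?H v \<partial>lborel)
      = l * (\<integral>u. indicator {l * e..} (0 + l * u) * ?H (0 + l * u) \<partial>lborel)"
    using lborel_integral_real_affine[of l "\<lambda>v. indicator {l * e..} v * ?H v" 0] l by simp
  also have "\<dots> = (\<integral>u. indicator {l * e..} (0 + l * u) * ?H (0 + l * u) * l \<partial>lborel)"
    by (subst integral_mult_left_zero) (rule mult.commute)
  also have "\<dots> = (\<integral>u. indicator {e..} u * (A (l * u) / u) \<partial>lborel)"
    by (simp only: eq)
  finally have sub: "(\<integral>u. indicator {e..} u * (A (l * u) / u) \<partial>lborel)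
      = (\<integral>v. indicator {l * e..} v * ?H v \<partial>lborel)" ..
  have AE: "AE v in lborel. indicator {l * e..e} v * ?H v
      = indicator {l * e..} v * ?H v - indicator {e..} v * ?H v"
    using AE_lborel_singleton[of e] by eventually_elim (use le in \<open>auto simp: indicator_def\<close>)
  \<comment> \<open>\<open>A\<close> is not assumed measurable, but \<open>A v / v\<close> is measurable on \<open>{l * e..}\<close>.\<close>
  have meas: "(\<lambda>v. indicator {l * e..e} v * ?H v) \<in> borel_measurable lborel"
  proof -
    have "(\<lambda>v. indicator {l * e..e} v * (indicator {l * e..} v * ?H v)) \<in> borel_measurable lborel"
      using borel_measurable_integrable[OF int[OF le(1)]] by measurable
    then show ?thesis
      by (rule measurable_cong[THEN iffD1, rotated]) (auto simp: indicator_def)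
  qed
  have "(\<integral>v. indicator {l * e..e} v * ?H v \<partial>lborel)
      = (\<integral>v. indicator {l * e..} v * ?H v - indicator {e..} v * ?H v \<partial>lborel)"
    using int[OF le(1)] int[OF e]
    by (intro integral_cong_AE AE meas borel_measurable_diff) (simp_all add: borel_measurable_integrable)
  also have "\<dots> = (\<integral>u. indicator {e..} u * (A (l * u) / u) \<partial>lborel) - (\<integral>v. indicator {e..} v * ?H v \<partial>lborel)"
    unfolding sub by (intro Bochner_Integration.integral_diff int le e)
  also have "\<dots> = (\<integral>u. indicator {e..} u * (A (l * u) / u) - indicator {e..} u * ?H u \<partial>lborel)"
    using int1 int[OF e] by (simp add: Bochner_Integration.integral_diff)
  finally have *: "(\<integral>u. indicator {e..} u * (A (l * u) / u) - indicator {e..} u * ?H u \<partial>lborel)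
     = (\<integral>v. indicator {l * e..e} v * ?H v \<partial>lborel)" ..
  have "has_bochner_integral lborel (\<lambda>u. indicator {e..} u * (A (l * u) / u) - indicator {e..} u * ?H u)
     (\<integral>v. indicator {l * e..e} v * ?H v \<partial>lborel)"
    using int1 int[OF e] * by (simp add: has_bochner_integral_iff)
  then show ?thesis
    by (simp add: diff_divide_distrib right_diff_distrib)
qed

lemma frullani_window_limit:
  fixes A :: "real \<Rightarrow> real"
  assumes l: "0 < l" "l < 1"
    and int: "\<And>e. 0 < e \<Longrightarrow> integrable lborel (\<lambda>u. indicator {e..} u * (A u / u))"
    and lim: "(A \<longlongrightarrow> L) (at_right 0)"
  shows "((\<lambda>e. \<integral>v. indicator {l * e..e} v * (A v / v) \<partial>lborel) \<longlongrightarrow> L * ln (1 / l)) (at_right 0)"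
proof (rule tendstoI)
  fix r :: real assume r: "0 < r"
  have ln_pos: "0 < ln (1 / l)" using l by simp
  \<comment> \<open>The factor 2 makes the final estimate \<open>d * ln (1 / l) < r\<close> strict.\<close>
  define d where "d = r / (2 * ln (1 / l))"
  have d: "0 < d" using r ln_pos by (simp add: d_def)
  obtain b where b: "0 < b" "\<And>v. 0 < v \<Longrightarrow> v < b \<Longrightarrow> \<bar>A v - L\<bar> < d"
    using tendstoD[OF lim d] by (auto simp: eventually_at_right_field dist_real_def)
  have "dist (\<integral>v. indicator {l * e..e} v * (A v / v) \<partial>lborel) (L * ln (1 / l)) < r"
    if e: "0 < e" "e < b" for e
  proof -
    let ?I = "indicator {l * e..e} :: real \<Rightarrow> real"
    have le: "0 < l * e" using l e by simp
    note inv = integral_inverse_Icc[OF l e(1)]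
    have "integrable lborel (\<lambda>v. ?I v * (indicator {l * e..} v * (A v / v)))"
      using int[OF le] integrable_real_mult_indicator[of "{l * e..e}" lborel "\<lambda>v. indicator {l * e..} v * (A v / v)"]
      by (simp add: mult.commute)
    then have intA: "integrable lborel (\<lambda>v. ?I v * (A v / v))"
      by (rule Bochner_Integration.integrable_cong[THEN iffD1, rotated -1]) (auto simp: indicator_def)
    have up: "(\<integral>v. ?I v * (A v / v) \<partial>lborel) \<le> (\<integral>v. (L + d) * (?I v * (1 / v)) \<partial>lborel)"
    proof (intro integral_mono intA)
      show "integrable lborel (\<lambda>v. (L + d) * (?I v * (1 / v)))"
        using inv by (intro integrable_mult_right) (simp add: has_bochner_integral_iff)
      show "?I v * (A v / v) \<le> (L + d) * (?I v * (1 / v))" for v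
      proof (cases "v \<in> {l * e..e}")
        case True
        then have "0 < v" "v < b" using le e by auto
        with b(2)[of v] True show ?thesis by (auto simp: divide_right_mono)
      qed auto
    qed
    have lo: "(\<integral>v. (L - d) * (?I v * (1 / v)) \<partial>lborel) \<le> (\<integral>v. ?I v * (A v / v) \<partial>lborel)"
    proof (intro integral_mono intA)
      show "integrable lborel (\<lambda>v. (L - d) * (?I v * (1 / v)))"
        using inv by (intro integrable_mult_right) (simp add: has_bochner_integral_iff)
      show "(L - d) * (?I v * (1 / v)) \<le> ?I v * (A v / v)" for v
      proof (cases "v \<in> {l * e..e}")
        case True
        then have "0 < v" "v < b" using le e by auto
        with b(2)[of v] True show ?thesis by (auto simp: divide_right_mono)
      qed auto
    qed
    have val: "(\<integral>v. c * (?I v * (1 / v)) \<partial>lborel) = c * ln (1 / l)" for c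
      using inv by (simp only: has_bochner_integral_iff Bochner_Integration.integral_mult_right_zero)
    have "\<bar>(\<integral>v. ?I v * (A v / v) \<partial>lborel) - L * ln (1 / l)\<bar> \<le> d * ln (1 / l)"
      using up lo unfolding val by (simp add: algebra_simps abs_le_iff)
    also have "\<dots> < r" using r ln_pos by (simp add: d_def)
    finally show ?thesis by (simp add: dist_real_def)
  qed
  then show "\<forall>\<^sub>F e in at_right 0. dist (\<integral>v. indicator {l * e..e} v * (A v / v) \<partial>lborel) (L * ln (1 / l)) < r"
    using b(1) by (auto simp: eventually_at_right_field)
qed

text \<open>
  The sign condition replaces any hypothesis on the rate of convergence of \<open>A\<close> at \<open>0\<close>: the truncated
  integrals increase as the truncation point decreases to \<open>0\<close>, and monotone convergence applies.
\<close>
lemma frullani_nonneg: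
  fixes A :: "real \<Rightarrow> real"
  assumes l: "0 < l" "l < 1"
    and meas: "A \<in> borel_measurable borel"
    and int: "\<And>e. 0 < e \<Longrightarrow> integrable lborel (\<lambda>u. indicator {e..} u * (A u / u))"
    and lim: "(A \<longlongrightarrow> L) (at_right 0)"
    and nonneg: "\<And>u. 0 < u \<Longrightarrow> A u \<le> A (l * u)"
  shows "has_bochner_integral lborel (\<lambda>u. indicator {0<..} u * ((A (l * u) - A u) / u)) (L * ln (1 / l))"
proof -
  note [measurable] = meas
  define E where "E = (\<lambda>n::nat. inverse (real (Suc n)))"
  have E: "0 < E n" for n by (simp add: E_def)
  have Edec: "E n \<le> E m" if "m \<le> n" for m n using that by (simp add: E_def)
  have Elim: "E \<longlonglongrightarrow> 0" unfolding E_def by (rule LIMSEQ_inverse_real_of_nat)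
  let ?G = "\<lambda>u. (A (l * u) - A u) / u"
  let ?f = "\<lambda>n u. indicator {E n..} u * ?G u"
  note tr = truncated_frullani[OF l E int]
  have Elim': "filterlim E (at_right 0) sequentially"
    using Elim by (auto simp: filterlim_at E_def)
  have ilim: "(\<lambda>n. integral\<^sup>L lborel (?f n)) \<longlonglongrightarrow> L * ln (1 / l)"
    using filterlim_compose[OF frullani_window_limit[OF l int lim] Elim'] tr
    by (simp add: has_bochner_integral_iff)
  have mono: "mono (\<lambda>n. ?f n u)" for u
  proof (intro monoI)
    fix m n :: nat assume "m \<le> n"
    then have "E n \<le> E m" by (rule Edec)
    moreover have "0 \<le> ?G u" if "0 < u" using nonneg[OF that] that by simp
    ultimately show "?f m u \<le> ?f n u"
      using E[of m] E[of n] by (auto simp: indicator_def)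
  qed
  have pos: "0 \<le> ?f n u" for n u
  proof (cases "E n \<le> u")
    case True
    then have "0 < u" using E[of n] by simp
    with nonneg[OF this] show ?thesis by simp
  qed simp
  have plim: "(\<lambda>n. ?f n u) \<longlonglongrightarrow> indicator {0<..} u * ?G u" for u
  proof (cases "0 < u")
    case True
    have "\<forall>\<^sub>F n in sequentially. E n < u" using order_tendstoD(2)[OF Elim True] .
    then have "\<forall>\<^sub>F n in sequentially. ?f n u = indicator {0<..} u * ?G u"
      by eventually_elim (use True in \<open>auto simp: indicator_def\<close>)
    then show ?thesis by (rule tendsto_eventually)
  next
    case False
    then have z: "?f n u = 0" for n using E[of n] by (auto simp: indicator_def)
    have z': "indicator {0<..} u * ?G u = 0" using False by simp
    show ?thesis unfolding z z' by (rule tendsto_const)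
  qed
  have m: "(\<lambda>u. indicator {0<..} u * ?G u) \<in> borel_measurable lborel" by measurable
  have i: "integrable lborel (?f n)" for n using tr by (simp add: has_bochner_integral_iff)
  show ?thesis
    unfolding has_bochner_integral_iff
    using integral_monotone_convergence_nonneg[OF i AE_I2[OF mono] AE_I2[OF pos] AE_I2[OF plim] ilim m] by simp
qed

section \<open>The cumulant series\<close>

text \<open>
  The right-hand side telescopes along \<open>s, l * s, l^2 * s, \<dots>\<close>, which is how the logarithmic moment
  comes to control the whole series.
\<close>
lemma one_minus_exp_le_telescope:
  fixes l s :: real
  assumes "0 < l" "l < 1" "0 \<le> s"
  shows "1 - exp (- s) \<le> 2 / (1 - l) * (ln (1 + s) - ln (1 + l * s))"
proof -
  have ls: "0 \<le> l * s" "l * s \<le> s" using assms by (auto intro: mult_left_le_one_le)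
  have "1 - exp (- s) \<le> s" using exp_ge_add_one_self[of "- s"] by simp
  moreover have "1 - exp (- s) \<le> 1" by simp
  ultimately have "(1 - exp (- s)) * (1 + s) \<le> s * 1 + 1 * s"
    unfolding distrib_left using assms by (intro add_mono mult_mono) auto
  then have 1: "1 - exp (- s) \<le> 2 * (s / (1 + s))"
    using assms by (simp add: field_simps)
  \<comment> \<open>\<open>ln t \<le> t - 1\<close> at \<open>t = (1 + l * s) / (1 + s)\<close>.\<close>
  have "ln ((1 + l * s) / (1 + s)) \<le> (1 + l * s) / (1 + s) - 1"
    using assms ls by (intro ln_le_minus_one) auto
  moreover have "ln ((1 + l * s) / (1 + s)) = ln (1 + l * s) - ln (1 + s)"
    using assms ls by (subst ln_div) (auto simp: add_pos_nonneg)
  moreover have "(1 + l * s) / (1 + s) - 1 = - ((1 - l) * (s / (1 + s)))"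
    using assms by (simp add: field_simps)
  ultimately have "(1 - l) * (s / (1 + s)) \<le> ln (1 + s) - ln (1 + l * s)" by simp
  then have "s / (1 + s) \<le> (ln (1 + s) - ln (1 + l * s)) / (1 - l)"
    using assms by (simp add: pos_le_divide_eq mult.commute)
  from mult_left_mono[OF this, of 2] 1 show ?thesis by simp
qed

lemma sum_exp_deviation_le:
  fixes l s :: real
  assumes l: "0 < l" "l < 1"
  shows "(\<Sum>k<n. \<bar>exp (l ^ k * s) - 1\<bar>) \<le> 2 / (1 - l) * ln (1 + \<bar>s\<bar>) + exp (2 * s) / (1 - l)"
proof (cases "0 \<le> s")
  case True
  have "\<bar>exp (l ^ k * s) - 1\<bar> \<le> l ^ k * exp (2 * s)" for k
  proof -
    let ?t = "l ^ k * s"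
    have t: "0 \<le> ?t" "?t \<le> s"
      using True l by (auto intro!: mult_left_le_one_le power_le_one)
    have "(1 - ?t) * exp ?t \<le> exp (- ?t) * exp ?t"
      using exp_ge_add_one_self[of "- ?t"] by (intro mult_right_mono) auto
    also have "exp (- ?t) * exp ?t = 1" by (simp flip: exp_add)
    finally have "exp ?t - 1 \<le> ?t * exp ?t" by (simp add: left_diff_distrib)
    also have "\<dots> \<le> ?t * exp s" using t by (intro mult_left_mono) auto
    also have "\<dots> \<le> (l ^ k * exp s) * exp s"
    proof (intro mult_right_mono mult_left_mono)
      show "s \<le> exp s" using exp_ge_add_one_self[of s] by linarith
    qed (use l in auto)
    also have "exp s * exp s = exp (2 * s)" by (simp flip: exp_add)
    then have "(l ^ k * exp s) * exp s = l ^ k * exp (2 * s)" by (simp only: mult.assoc)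
    finally show ?thesis using t by simp
  qed
  then have "(\<Sum>k<n. \<bar>exp (l ^ k * s) - 1\<bar>) \<le> (\<Sum>k<n. l ^ k) * exp (2 * s)"
    by (simp add: sum_distrib_right sum_mono)
  also have "\<dots> \<le> 1 / (1 - l) * exp (2 * s)"
    using l by (intro mult_right_mono) (auto simp: sum_gp_strict divide_right_mono)
  also have "\<dots> \<le> 2 / (1 - l) * ln (1 + \<bar>s\<bar>) + exp (2 * s) / (1 - l)"
    using l by simp
  finally show ?thesis .
next
  case False
  define w where "w = - s"
  have w: "0 \<le> w" using False by (simp add: w_def)
  define L where "L k = ln (1 + l ^ k * w)" for k
  have "\<bar>exp (l ^ k * s) - 1\<bar> \<le> 2 / (1 - l) * (L k - L (Suc k))" for k
  proof -
    have "0 \<le> l ^ k * w" using w l by simp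
    from one_minus_exp_le_telescope[OF l this]
    have "1 - exp (l ^ k * s) \<le> 2 / (1 - l) * (L k - L (Suc k))"
      by (simp add: L_def w_def mult.assoc)
    moreover have "exp (l ^ k * s) \<le> 1"
      using False l by (simp add: mult_le_0_iff)
    ultimately show ?thesis by simp
  qed
  then have "(\<Sum>k<n. \<bar>exp (l ^ k * s) - 1\<bar>) \<le> (\<Sum>k<n. 2 / (1 - l) * (L k - L (Suc k)))"
    by (rule sum_mono)
  also have "\<dots> = 2 / (1 - l) * (L 0 - L n)"
    by (simp only: sum_distrib_left[symmetric] sum_lessThan_telescope')
  also have "\<dots> \<le> 2 / (1 - l) * ln (1 + \<bar>s\<bar>)"
  proof (rule mult_left_mono)
    have "0 \<le> L n" unfolding L_def using w l by (intro ln_ge_zero) simp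
    then show "L 0 - L n \<le> ln (1 + \<bar>s\<bar>)" using False by (simp add: L_def w_def)
  qed (use l in simp)
  also have "\<dots> \<le> 2 / (1 - l) * ln (1 + \<bar>s\<bar>) + exp (2 * s) / (1 - l)"
    using l by simp
  finally show ?thesis .
qed

lemma abs_exp_mult_minus_one_mono:
  fixes u v y :: real
  assumes "0 \<le> u" "u \<le> v"
  shows "\<bar>exp (u * y) - 1\<bar> \<le> \<bar>exp (v * y) - 1\<bar>"
proof (cases "0 \<le> y")
  case True
  then have "0 \<le> u * y" "u * y \<le> v * y" using assms by (auto intro: mult_right_mono)
  then have "1 \<le> exp (u * y)" "exp (u * y) \<le> exp (v * y)" by auto
  then show ?thesis by linarith
next
  case False
  then have "u * y \<le> 0" "v * y \<le> u * y" using assms by (auto intro: mult_right_mono_neg simp: mult_le_0_iff)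
  then have "exp (u * y) \<le> 1" "exp (v * y) \<le> exp (u * y)" by auto
  then show ?thesis by linarith
qed

text \<open>
  A random variable with exponential moments on the right and a logarithmic moment, together with a
  contraction factor \<open>l\<close>.
\<close>
locale ar1_innovation = prob_space M for M :: "'a measure" +
  fixes Y :: "'a \<Rightarrow> real" and l :: real
  assumes l: "0 < l" "l < 1"
    and Y_meas [measurable]: "Y \<in> borel_measurable M"
    and exp_integrable: "\<And>u. 0 \<le> u \<Longrightarrow> integrable M (\<lambda>\<omega>. exp (u * Y \<omega>))"
    and log_integrable: "integrable M (\<lambda>\<omega>. ln (1 + \<bar>Y \<omega>\<bar>))"
begin

text \<open>The moment generating function; only its values at \<open>u \<ge> 0\<close> are meaningful.\<close>
definition mgf :: "real \<Rightarrow> real" where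
  "mgf u = (\<integral>\<omega>. exp (u * Y \<omega>) \<partial>M)"

text \<open>
  The expected absolute deviation of \<open>exp (u * Y)\<close> from 1.  Unlike \<open>\<bar>mgf u - 1\<bar>\<close>, which it dominates for \<open>u \<ge> 0\<close>, it
  is increasing in \<open>u\<close> for \<open>u \<ge> 0\<close>, so that the estimates of the cumulant series are uniform on bounded
  intervals.
\<close>
definition exp_dev :: "real \<Rightarrow> real" where
  "exp_dev u = (\<integral>\<omega>. \<bar>exp (u * Y \<omega>) - 1\<bar> \<partial>M)"

abbreviation \<psi> :: "real \<Rightarrow> real" where "\<psi> \<equiv> cumulant M Y"
abbreviation \<phi> :: "real \<Rightarrow> real" where "\<phi> \<equiv> cumulant_series M l Y"

lemma exp_dev_integrable: "0 \<le> u \<Longrightarrow> integrable M (\<lambda>\<omega>. \<bar>exp (u * Y \<omega>) - 1\<bar>)"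
  using exp_integrable by (intro integrable_abs Bochner_Integration.integrable_diff) auto

lemma exp_dev_nonneg: "0 \<le> exp_dev u"
  unfolding exp_dev_def by simp

lemma exp_dev_mono: "0 \<le> u \<Longrightarrow> u \<le> v \<Longrightarrow> exp_dev u \<le> exp_dev v"
  unfolding exp_dev_def
  by (intro integral_mono exp_dev_integrable abs_exp_mult_minus_one_mono) auto

lemma exp_dev_summable:
  assumes u: "0 \<le> u"
  shows "summable (\<lambda>k. exp_dev (l ^ k * u))"
proof (rule summableI_nonneg_bounded)
  fix n
  have lk: "0 \<le> l ^ k * u" for k using l u by simp
  have ln_le: "ln (1 + \<bar>u * Y \<omega>\<bar>) \<le> ln (1 + u) + ln (1 + \<bar>Y \<omega>\<bar>)" for \<omega>
  proof -
    have "ln (1 + \<bar>u * Y \<omega>\<bar>) \<le> ln ((1 + u) * (1 + \<bar>Y \<omega>\<bar>))"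
      using u by (subst ln_le_cancel_iff) (auto simp: abs_mult algebra_simps add_pos_nonneg)
    also have "\<dots> = ln (1 + u) + ln (1 + \<bar>Y \<omega>\<bar>)"
      using u by (subst ln_mult) auto
    finally show ?thesis .
  qed
  let ?B = "\<lambda>\<omega>. 2 / (1 - l) * (ln (1 + u) + ln (1 + \<bar>Y \<omega>\<bar>)) + exp (2 * u * Y \<omega>) / (1 - l)"
  have "(\<Sum>k<n. exp_dev (l ^ k * u)) = (\<integral>\<omega>. (\<Sum>k<n. \<bar>exp (l ^ k * u * Y \<omega>) - 1\<bar>) \<partial>M)"
    unfolding exp_dev_def by (intro Bochner_Integration.integral_sum[symmetric] exp_dev_integrable lk)
  also have "\<dots> \<le> (\<integral>\<omega>. ?B \<omega> \<partial>M)"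
  proof (intro integral_mono Bochner_Integration.integrable_sum exp_dev_integrable lk)
    show "integrable M ?B"
      using exp_integrable[of "2 * u"] log_integrable u
      by (intro Bochner_Integration.integrable_add integrable_mult_right integrable_divide) auto
    show "(\<Sum>k<n. \<bar>exp (l ^ k * u * Y \<omega>) - 1\<bar>) \<le> ?B \<omega>" for \<omega>
    proof -
      have "2 / (1 - l) * ln (1 + \<bar>u * Y \<omega>\<bar>) \<le> 2 / (1 - l) * (ln (1 + u) + ln (1 + \<bar>Y \<omega>\<bar>))"
        using l by (intro mult_left_mono ln_le) auto
      with sum_exp_deviation_le[OF l, of "u * Y \<omega>" n] show ?thesis
        by (simp add: mult.assoc)
    qed
  qed
  finally show "(\<Sum>k<n. exp_dev (l ^ k * u)) \<le> (\<integral>\<omega>. ?B \<omega> \<partial>M)" .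
qed (rule exp_dev_nonneg)

text \<open>\<open>exp (v * Y) \<ge> min 1 (exp (u * Y))\<close> for \<open>0 \<le> v \<le> u\<close>, and the right-hand side has positive mean.\<close>
lemma mgf_lower_bound:
  obtains c where "0 < c" "\<And>v. 0 \<le> v \<Longrightarrow> v \<le> u \<Longrightarrow> c \<le> mgf v"
proof
  let ?c = "\<integral>\<omega>. min 1 (exp (u * Y \<omega>)) \<partial>M"
  have int: "integrable M (\<lambda>\<omega>. min 1 (exp (u * Y \<omega>)))"
    by (rule integrable_const_bound[of _ 1]) auto
  have "?c \<noteq> 0"
  proof
    assume "?c = 0"
    then have "AE \<omega> in M. min 1 (exp (u * Y \<omega>)) = 0"
      using int by (subst (asm) integral_nonneg_eq_0_iff_AE) auto
    moreover have "min 1 (exp (u * Y \<omega>)) \<noteq> 0" for \<omega>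
      using exp_gt_zero[of "u * Y \<omega>"] by (simp add: min_def del: exp_gt_zero)
    ultimately have "AE \<omega> in M. False" by simp
    then show False by simp
  qed
  moreover have "0 \<le> ?c" by (intro Bochner_Integration.integral_nonneg) simp
  ultimately show "0 < ?c" by linarith
  show "?c \<le> mgf v" if v: "0 \<le> v" "v \<le> u" for v
    unfolding mgf_def
  proof (intro integral_mono int exp_integrable v)
    show "min 1 (exp (u * Y \<omega>)) \<le> exp (v * Y \<omega>)" for \<omega>
    proof (cases "0 \<le> Y \<omega>")
      case True
      with v show ?thesis by (intro min.coboundedI1) simp
    next
      case False
      with v show ?thesis by (intro min.coboundedI2) (simp add: mult_right_mono_neg)
    qed
  qed
qed

lemma mgf_pos: "0 \<le> u \<Longrightarrow> 0 < mgf u"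
  by (rule mgf_lower_bound[of u]) (meson order_less_le_trans order_refl)

lemma abs_mgf_minus_one_le: "0 \<le> u \<Longrightarrow> \<bar>mgf u - 1\<bar> \<le> exp_dev u"
proof -
  assume u: "0 \<le> u"
  have "mgf u - 1 = (\<integral>\<omega>. exp (u * Y \<omega>) - 1 \<partial>M)"
    unfolding mgf_def using exp_integrable[OF u] by (simp add: Bochner_Integration.integral_diff prob_space)
  then show ?thesis unfolding exp_dev_def by (simp add: integral_abs_bound)
qed

text \<open>Both bounds come from \<open>ln t \<le> t - 1\<close>, applied at \<open>t = mgf v\<close> and at \<open>t = 1 / mgf v\<close>.\<close>
lemma abs_cumulant_le:
  obtains K where "0 \<le> K" "\<And>v. 0 \<le> v \<Longrightarrow> v \<le> u \<Longrightarrow> \<bar>\<psi> v\<bar> \<le> K * exp_dev v"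
proof -
  obtain c where c: "0 < c" "\<And>v. 0 \<le> v \<Longrightarrow> v \<le> u \<Longrightarrow> c \<le> mgf v"
    by (rule mgf_lower_bound[of u]) blast
  have "\<bar>\<psi> v\<bar> \<le> (1 + 1 / c) * exp_dev v" if v: "0 \<le> v" "v \<le> u" for v
  proof -
    have m: "0 < mgf v" "c \<le> mgf v" using c v mgf_pos by auto
    have psi: "\<psi> v = ln (mgf v)" by (simp add: cumulant_def mgf_def)
    have d: "\<bar>mgf v - 1\<bar> \<le> exp_dev v" using abs_mgf_minus_one_le v by simp
    have q: "0 \<le> exp_dev v" by (rule exp_dev_nonneg)
    have "ln (mgf v) \<le> exp_dev v" using ln_le_minus_one[OF m(1)] d by linarith
    moreover have "- ln (mgf v) \<le> exp_dev v / c"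
    proof -
      have "- ln (mgf v) = ln (1 / mgf v)" using m by (simp add: ln_div)
      also have "\<dots> \<le> 1 / mgf v - 1" using m by (intro ln_le_minus_one) simp
      also have "\<dots> = (1 - mgf v) / mgf v" using m by (simp add: field_simps)
      also have "\<dots> \<le> exp_dev v / mgf v" using d m by (intro divide_right_mono) linarith+
      also have "\<dots> \<le> exp_dev v / c" using m c q by (intro divide_left_mono) auto
      finally show ?thesis .
    qed
    moreover have "0 \<le> exp_dev v / c" using q c by simp
    ultimately show ?thesis unfolding psi using q by (simp add: algebra_simps abs_le_iff)
  qed
  with c(1) that[of "1 + 1 / c"] show thesis by auto
qed

lemma scaled_le: "0 \<le> u \<Longrightarrow> 0 \<le> l ^ k * u \<and> l ^ k * u \<le> u"
  using l by (auto intro!: mult_left_le_one_le power_le_one)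

lemma cumulant_series_bound:
  obtains K where "0 \<le> K"
    "\<And>v. 0 \<le> v \<Longrightarrow> v \<le> u \<Longrightarrow> summable (\<lambda>k. \<psi> (l ^ k * v))"
    "\<And>v. 0 \<le> v \<Longrightarrow> v \<le> u \<Longrightarrow> \<bar>\<phi> v\<bar> \<le> K * (\<Sum>k. exp_dev (l ^ k * v))"
proof -
  obtain K where K: "0 \<le> K" "\<And>v. 0 \<le> v \<Longrightarrow> v \<le> u \<Longrightarrow> \<bar>\<psi> v\<bar> \<le> K * exp_dev v"
    by (rule abs_cumulant_le[of u]) blast
  have le: "norm (\<psi> (l ^ k * v)) \<le> K * exp_dev (l ^ k * v)" if "0 \<le> v" "v \<le> u" for v k
    using K(2)[of "l ^ k * v"] scaled_le[OF that(1), of k] that by simp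
  have sK: "summable (\<lambda>k. K * exp_dev (l ^ k * v))" if "0 \<le> v" for v
    using exp_dev_summable[OF that] by (rule summable_mult)
  have sn: "summable (\<lambda>k. norm (\<psi> (l ^ k * v)))" if "0 \<le> v" "v \<le> u" for v
    by (rule summable_comparison_test'[OF sK[OF that(1)], of 0]) (simp only: real_norm_def abs_idempotent le[OF that, unfolded real_norm_def])
  have "\<bar>\<phi> v\<bar> \<le> K * (\<Sum>k. exp_dev (l ^ k * v))" if v: "0 \<le> v" "v \<le> u" for v
  proof -
    have "\<bar>\<phi> v\<bar> \<le> (\<Sum>k. norm (\<psi> (l ^ k * v)))"
      unfolding cumulant_series_def using summable_norm[OF sn[OF v]] by simp
    also have "\<dots> \<le> (\<Sum>k. K * exp_dev (l ^ k * v))"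
      using le[OF v] sn[OF v] sK[OF v(1)] by (rule suminf_le)
    also have "\<dots> = K * (\<Sum>k. exp_dev (l ^ k * v))"
      using exp_dev_summable[OF v(1)] by (rule suminf_mult)
    finally show ?thesis .
  qed
  moreover have "summable (\<lambda>k. \<psi> (l ^ k * v))" if "0 \<le> v" "v \<le> u" for v
    using sn[OF that] by (rule summable_norm_cancel)
  ultimately show thesis by (intro that[OF K(1)])
qed

lemma exp_neg_cumulant_series_step:
  assumes u: "0 \<le> u"
  shows "exp (- \<phi> u) * mgf u = exp (- \<phi> (l * u))"
proof -
  have s: "summable (\<lambda>k. \<psi> (l ^ k * u))"
    by (rule cumulant_series_bound[of u]) (use u in blast)
  have "\<phi> u = (\<Sum>k. \<psi> (l ^ Suc k * u)) + \<psi> u"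
    unfolding cumulant_series_def using suminf_split_head[OF s] by simp
  also have "(\<Sum>k. \<psi> (l ^ Suc k * u)) = \<phi> (l * u)"
    unfolding cumulant_series_def by (simp add: mult_ac)
  finally have "- \<phi> u + \<psi> u = - \<phi> (l * u)" by simp
  moreover have "mgf u = exp (\<psi> u)" using mgf_pos[OF u] by (simp add: cumulant_def mgf_def)
  ultimately show ?thesis by (simp flip: exp_add)
qed

lemma exp_dev_series_mono:
  "0 \<le> u \<Longrightarrow> u \<le> v \<Longrightarrow> (\<Sum>k. exp_dev (l ^ k * u)) \<le> (\<Sum>k. exp_dev (l ^ k * v))"
  using l by (intro suminf_le exp_dev_summable exp_dev_mono mult_left_mono) auto

lemma cumulant_series_bounded:
  obtains B where "\<And>u. 0 \<le> u \<Longrightarrow> u \<le> b \<Longrightarrow> \<bar>\<phi> u\<bar> \<le> B"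
proof -
  obtain K where K: "0 \<le> K" "\<And>v. 0 \<le> v \<Longrightarrow> v \<le> b \<Longrightarrow> \<bar>\<phi> v\<bar> \<le> K * (\<Sum>k. exp_dev (l ^ k * v))"
    by (rule cumulant_series_bound[of b]) blast
  have "\<bar>\<phi> u\<bar> \<le> K * (\<Sum>k. exp_dev (l ^ k * b))" if u: "0 \<le> u" "u \<le> b" for u
    using K(2)[OF u] mult_left_mono[OF exp_dev_series_mono[OF u] K(1)] by simp
  then show thesis by (rule that)
qed

text \<open>For \<open>u < l ^ n\<close> the series is dominated by the tail of order \<open>n\<close> of the series at \<open>1\<close>.\<close>
lemma cumulant_series_tendsto_0: "(\<phi> \<longlongrightarrow> 0) (at_right 0)"
proof (rule tendstoI)
  fix r :: real assume r: "0 < r"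
  obtain K where K: "0 \<le> K" "\<And>v. 0 \<le> v \<Longrightarrow> v \<le> 1 \<Longrightarrow> \<bar>\<phi> v\<bar> \<le> K * (\<Sum>k. exp_dev (l ^ k * v))"
    by (rule cumulant_series_bound[of 1]) blast
  let ?q = "\<lambda>k. exp_dev (l ^ k * 1)"
  have s: "summable ?q" by (rule exp_dev_summable) simp
  have "(\<lambda>n. K * (\<Sum>k. ?q (k + n))) \<longlonglongrightarrow> K * 0"
    by (intro tendsto_intros suminf_exist_split2 s)
  then have "\<forall>\<^sub>F n in sequentially. K * (\<Sum>k. ?q (k + n)) < r"
    using r by (intro order_tendstoD) auto
  then obtain n where n: "K * (\<Sum>k. ?q (k + n)) < r"
    by (auto simp: eventually_sequentially)
  have ln: "0 < l ^ n" "l ^ n \<le> 1" using l by (auto intro: power_le_one)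
  have "dist (\<phi> u) 0 < r" if u: "0 < u" "u < l ^ n" for u
  proof -
    have "(\<Sum>k. exp_dev (l ^ k * u)) \<le> (\<Sum>k. exp_dev (l ^ k * l ^ n))"
      using u by (intro exp_dev_series_mono) auto
    also have "\<dots> = (\<Sum>k. ?q (k + n))" by (simp add: power_add)
    finally have "K * (\<Sum>k. exp_dev (l ^ k * u)) \<le> K * (\<Sum>k. ?q (k + n))"
      using K(1) by (rule mult_left_mono)
    with K(2)[of u] n u ln show ?thesis by simp
  qed
  then show "\<forall>\<^sub>F u in at_right 0. dist (\<phi> u) 0 < r"
    using ln(1) by (auto simp: eventually_at_right_field)
qed

lemma cumulant_series_measurable [measurable]: "\<phi> \<in> borel_measurable borel"
  unfolding cumulant_series_def[abs_def] cumulant_def by measurable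

end

section \<open>First passage times and measurability\<close>

lemma enat_less_first_passage_iff:
  "enat k < first_passage X a \<omega> \<longleftrightarrow> (\<forall>j\<le>k. X j \<omega> \<le> a)"
proof
  assume k: "enat k < first_passage X a \<omega>"
  show "\<forall>j\<le>k. X j \<omega> \<le> a"
  proof (intro allI impI, rule ccontr)
    fix j assume "j \<le> k" "\<not> X j \<omega> \<le> a"
    then have "first_passage X a \<omega> \<le> enat j"
      unfolding first_passage_def by (intro Inf_lower) auto
    also have "\<dots> \<le> enat k" using \<open>j \<le> k\<close> by simp
    finally show False using k by simp
  qed
next
  assume *: "\<forall>j\<le>k. X j \<omega> \<le> a"
  have "enat k < enat (Suc k)" by simp
  also have "\<dots> \<le> first_passage X a \<omega>"
    unfolding first_passage_def using * by (intro Inf_greatest) (auto simp: not_le[symmetric] Suc_le_eq)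
  finally show "enat k < first_passage X a \<omega>" .
qed

lemma first_passage_eq_enat_iff:
  "first_passage X a \<omega> = enat k \<longleftrightarrow> X k \<omega> > a \<and> (\<forall>j<k. X j \<omega> \<le> a)"
proof -
  let ?T = "first_passage X a \<omega>"
  have "?T = enat k \<longleftrightarrow> \<not> enat k < ?T \<and> (\<forall>j<k. enat j < ?T)"
  proof (cases ?T)
    case (enat n)
    then show ?thesis by (auto simp: not_less order_antisym_conv le_less)
  qed auto
  also have "\<dots> \<longleftrightarrow> \<not> (\<forall>j\<le>k. X j \<omega> \<le> a) \<and> (\<forall>j<k. X j \<omega> \<le> a)"
    unfolding enat_less_first_passage_iff by (meson le_less_trans order_refl)
  also have "\<dots> \<longleftrightarrow> X k \<omega> > a \<and> (\<forall>j<k. X j \<omega> \<le> a)"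
    by (auto simp: le_less)
  finally show ?thesis .
qed

lemma first_passage_measurable:
  assumes [measurable]: "\<And>n. X n \<in> borel_measurable M"
  shows "first_passage X a \<in> measurable M (count_space UNIV)"
proof -
  have "first_passage X a -` {T} \<inter> space M \<in> sets M" for T
  proof (cases T)
    case (enat k)
    have "first_passage X a -` {T} \<inter> space M = {\<omega> \<in> space M. X k \<omega> > a \<and> (\<forall>j<k. X j \<omega> \<le> a)}"
      unfolding enat using first_passage_eq_enat_iff[of X a _ k] by auto
    also have "\<dots> \<in> sets M" by measurable
    finally show ?thesis .
  next
    case infinity
    have "T' = \<infinity> \<longleftrightarrow> (\<forall>k. enat k < T')" for T' by (cases T') auto
    then have "first_passage X a -` {T} \<inter> space M = {\<omega> \<in> space M. \<forall>k. \<forall>j\<le>k. X j \<omega> \<le> a}"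
      unfolding infinity using enat_less_first_passage_iff[of _ X a] by auto
    also have "\<dots> \<in> sets M" by measurable
    finally show ?thesis .
  qed
  then show ?thesis by (subst measurable_count_space_eq2_countable) auto
qed

text \<open>
  The next two lemmas express \<open>X j\<close> for \<open>j \<le> k\<close> as a measurable function of the innovations with indices
  in \<open>{1..k}\<close>: the innovations are replaced by the coordinate functions of the product space.
\<close>
lemma ar1_measurable_PiM:
  assumes "j \<le> k"
  shows "(\<lambda>f. ar1 l x (\<lambda>i w. w i) j f) \<in> borel_measurable (PiM {1..k} (\<lambda>_. borel))"
  using assms
proof (induction j)
  case (Suc j)
  have "(\<lambda>f. f (Suc j)) \<in> borel_measurable (PiM {1..k} (\<lambda>_. borel :: real measure))"
    using Suc.prems by (intro measurable_component_singleton) auto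
  then show ?case using Suc by simp
next
  case 0
  have "ar1 l x (\<lambda>i w. w i) 0 = (\<lambda>_. x)" by (simp add: fun_eq_iff)
  then show ?case by simp
qed

lemma ar1_restrict:
  assumes "j \<le> k"
  shows "ar1 l x (\<lambda>i w. w i) j (restrict (\<lambda>i. \<eta> i \<omega>) {1..k}) = ar1 l x \<eta> j \<omega>"
  using assms by (induction j) auto

section \<open>The process before the passage time\<close>

locale ar1_passage = ar1_innovation M "\<eta> 1" l
  for M :: "'a measure" and \<eta> :: "nat \<Rightarrow> 'a \<Rightarrow> real" and l :: real +
  fixes x a :: real
  assumes iid: "iid_seq M \<eta>"
    and start: "x \<le> a"
    and finite_mean: "expected_time M (first_passage (ar1 l x \<eta>) a) < \<infinity>"
begin

abbreviation X :: "nat \<Rightarrow> 'a \<Rightarrow> real" where "X \<equiv> ar1 l x \<eta>"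
abbreviation \<tau> :: "'a \<Rightarrow> enat" where "\<tau> \<equiv> first_passage X a"

lemma eta_measurable: "1 \<le> n \<Longrightarrow> \<eta> n \<in> borel_measurable M"
  using iid unfolding iid_seq_def indep_vars_def by auto

lemma X_measurable [measurable]: "X n \<in> borel_measurable M"
proof (induction n)
  case (Suc n)
  have "\<eta> (Suc n) \<in> borel_measurable M" by (rule eta_measurable) simp
  with Suc have "(\<lambda>\<omega>. l * X n \<omega> + \<eta> (Suc n) \<omega>) \<in> borel_measurable M" by measurable
  then show ?case by (simp add: fun_eq_iff[of "X (Suc n)"] cong: measurable_cong)
next
  case 0
  have "X 0 = (\<lambda>_. x)" by (simp add: fun_eq_iff)
  then show ?case by simp
qed

lemma tau_measurable [measurable]: "\<tau> \<in> measurable M (count_space UNIV)"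
  by (rule first_passage_measurable) (rule X_measurable)

text \<open>\<open>exp (u * X k)\<close> on the event \<open>\<tau> > k\<close>, and 0 elsewhere.\<close>
definition alive_exp :: "nat \<Rightarrow> real \<Rightarrow> 'a \<Rightarrow> real" where
  "alive_exp k u \<omega> = of_bool (\<forall>j\<le>k. X j \<omega> \<le> a) * exp (u * X k \<omega>)"

text \<open>\<open>exp (u * X k)\<close> on the event \<open>\<tau> = k\<close>, and 0 elsewhere.\<close>
definition cross_exp :: "nat \<Rightarrow> real \<Rightarrow> 'a \<Rightarrow> real" where
  "cross_exp k u \<omega> = of_bool (X k \<omega> > a \<and> (\<forall>j<k. X j \<omega> \<le> a)) * exp (u * X k \<omega>)"

lemma alive_exp_measurable_pair [measurable]:
  "(\<lambda>(u, \<omega>). alive_exp k u \<omega>) \<in> borel_measurable (borel \<Otimes>\<^sub>M M)"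
  unfolding alive_exp_def by measurable

lemma alive_exp_measurable [measurable]: "alive_exp k u \<in> borel_measurable M"
  unfolding alive_exp_def by measurable

lemma cross_exp_measurable [measurable]: "cross_exp k u \<in> borel_measurable M"
  unfolding cross_exp_def by measurable

lemma alive_exp_nonneg: "0 \<le> alive_exp k u \<omega>" and cross_exp_nonneg: "0 \<le> cross_exp k u \<omega>"
  by (auto simp: alive_exp_def cross_exp_def)

lemma alive_exp_le:
  assumes "0 \<le> u"
  shows "alive_exp k u \<omega> \<le> exp (u * a) * alive_exp k 0 \<omega>"
  using assms by (auto simp: alive_exp_def mult_left_mono)

lemma alive_exp_integrable: "0 \<le> u \<Longrightarrow> integrable M (alive_exp k u)"
  by (rule integrable_const_bound[of _ "exp (u * a)"])
     (auto simp: alive_exp_def mult_left_mono)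

text \<open>The moment generating function of the law of \<open>X k\<close> restricted to \<open>\<tau> > k\<close>.\<close>
definition alive_mgf :: "nat \<Rightarrow> real \<Rightarrow> real" where
  "alive_mgf k u = (\<integral>\<omega>. alive_exp k u \<omega> \<partial>M)"

lemma alive_mgf_measurable [measurable]: "alive_mgf k \<in> borel_measurable borel"
  unfolding alive_mgf_def by measurable

lemma alive_mgf_nonneg: "0 \<le> alive_mgf k u"
  unfolding alive_mgf_def by (intro Bochner_Integration.integral_nonneg alive_exp_nonneg)

lemma alive_mgf_le: "0 \<le> u \<Longrightarrow> alive_mgf k u \<le> exp (u * a) * alive_mgf k 0"
  unfolding alive_mgf_def
  by (subst Bochner_Integration.integral_mult_right_zero[symmetric])
     (intro integral_mono alive_exp_integrable integrable_mult_right alive_exp_le, auto)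

lemma expectation_exp_eta:
  assumes n: "1 \<le> n" and u: "0 \<le> u"
  shows "has_bochner_integral M (\<lambda>\<omega>. exp (u * \<eta> n \<omega>)) (mgf u)"
proof -
  have d: "distr M borel (\<eta> n) = distr M borel (\<eta> 1)"
    using iid n unfolding iid_seq_def by blast
  note [measurable] = eta_measurable[OF n]
  have "has_bochner_integral (distr M borel (\<eta> 1)) (\<lambda>y. exp (u * y)) (mgf u)"
    using exp_integrable[OF u] by (intro has_bochner_integral_distr) (auto simp: has_bochner_integral_iff mgf_def simp del: One_nat_def)
  then have "has_bochner_integral (distr M borel (\<eta> n)) (\<lambda>y. exp (u * y)) (mgf u)"
    by (simp only: d)
  then show ?thesis
    by (simp add: has_bochner_integral_iff integrable_distr_eq integral_distr)
qed

text \<open>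
  The event \<open>\<tau> > k\<close> and \<open>X k\<close> are determined by the innovations up to time \<open>k\<close>, hence independent of the
  innovation at time \<open>k + 1\<close>.
\<close>
lemma alive_exp_step:
  assumes u: "0 \<le> u"
  shows "has_bochner_integral M (\<lambda>\<omega>. alive_exp k (l * u) \<omega> * exp (u * \<eta> (Suc k) \<omega>)) (alive_mgf k (l * u) * mgf u)"
proof -
  let ?P = "\<lambda>f. of_bool (\<forall>j\<le>k. ar1 l x (\<lambda>i w. w i) j f \<le> a) * exp (l * u * ar1 l x (\<lambda>i w. w i) k f)"
  let ?past = "\<lambda>\<omega>. restrict (\<lambda>i. \<eta> i \<omega>) {1..k}" and ?next = "\<lambda>\<omega>. restrict (\<lambda>i. \<eta> i \<omega>) {Suc k}"
  have P: "?P \<in> borel_measurable (PiM {1..k} (\<lambda>_. borel))"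
  proof -
    have "Measurable.pred (PiM {1..k} (\<lambda>_. borel)) (\<lambda>f. \<forall>j\<in>{..k}. ar1 l x (\<lambda>i w. w i) j f \<le> a)"
    proof (intro pred_intros_finite)
      fix j assume "j \<in> {..k}"
      then have [measurable]: "ar1 l x (\<lambda>i w. w i) j \<in> borel_measurable (PiM {1..k} (\<lambda>_. borel))"
        using ar1_measurable_PiM[of j k l x] by simp
      show "Measurable.pred (PiM {1..k} (\<lambda>_. borel)) (\<lambda>f. ar1 l x (\<lambda>i w. w i) j f \<le> a)"
        by measurable
    qed simp
    then have "Measurable.pred (PiM {1..k} (\<lambda>_. borel)) (\<lambda>f. \<forall>j\<le>k. ar1 l x (\<lambda>i w. w i) j f \<le> a)"
      by (simp only: Ball_def atMost_iff)
    moreover have "(\<lambda>f. ar1 l x (\<lambda>i w. w i) k f) \<in> borel_measurable (PiM {1..k} (\<lambda>_. borel))"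
      by (rule ar1_measurable_PiM) simp
    ultimately show ?thesis by measurable
  qed
  have N: "(\<lambda>g. exp (u * g (Suc k))) \<in> borel_measurable (PiM {Suc k} (\<lambda>_. borel))"
    by measurable
  have "indep_var (PiM {1..k} (\<lambda>_. borel)) ?past (PiM {Suc k} (\<lambda>_. borel)) ?next"
    using iid unfolding iid_seq_def by (intro indep_var_restrict[where I="{1..}"]) auto
  from indep_var_compose[OF this P N]
  have "indep_var borel (?P \<circ> ?past) borel ((\<lambda>g. exp (u * g (Suc k))) \<circ> ?next)" .
  moreover have "?P \<circ> ?past = alive_exp k (l * u)"
    by (auto simp: fun_eq_iff alive_exp_def ar1_restrict simp del: One_nat_def)
  moreover have "(\<lambda>g. exp (u * g (Suc k))) \<circ> ?next = (\<lambda>\<omega>. exp (u * \<eta> (Suc k) \<omega>))"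
    by (auto simp: fun_eq_iff)
  ultimately have ind: "indep_var borel (alive_exp k (l * u)) borel (\<lambda>\<omega>. exp (u * \<eta> (Suc k) \<omega>))"
    by simp
  have e: "has_bochner_integral M (\<lambda>\<omega>. exp (u * \<eta> (Suc k) \<omega>)) (mgf u)"
    using u by (intro expectation_exp_eta) auto
  have i: "integrable M (alive_exp k (l * u))" using l u by (intro alive_exp_integrable) simp
  show ?thesis
    using indep_var_integrable[OF ind i] indep_var_lebesgue_integral[OF ind i] e
    by (simp add: has_bochner_integral_iff alive_mgf_def)
qed

text \<open>The event \<open>\<tau> \<ge> k\<close> is the disjoint union of \<open>\<tau> = k\<close> and \<open>\<tau> > k\<close>.\<close>
lemma cross_plus_alive_exp:
  "cross_exp k u \<omega> + alive_exp k u \<omega> = of_bool (\<forall>j<k. X j \<omega> \<le> a) * exp (u * X k \<omega>)"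
  by (auto simp: cross_exp_def alive_exp_def le_less)

lemma cross_exp_0:
  "cross_exp 0 u \<omega> = 0" "alive_exp 0 u \<omega> = exp (u * x)"
  using start by (auto simp: cross_exp_def alive_exp_def)

lemma cross_exp_Suc:
  "cross_exp (Suc k) u \<omega> = alive_exp k (l * u) \<omega> * exp (u * \<eta> (Suc k) \<omega>) - alive_exp (Suc k) u \<omega>"
proof -
  have "cross_exp (Suc k) u \<omega> + alive_exp (Suc k) u \<omega> = alive_exp k (l * u) \<omega> * exp (u * \<eta> (Suc k) \<omega>)"
    unfolding cross_plus_alive_exp by (simp add: alive_exp_def less_Suc_eq_le distrib_left exp_add mult_ac)
  then show ?thesis by simp
qed

lemma alive_mgf_0: "alive_mgf 0 u = exp (u * x)"
  unfolding alive_mgf_def cross_exp_0 by (simp add: prob_space)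

lemma cross_exp_expectation_Suc:
  assumes u: "0 \<le> u"
  shows "has_bochner_integral M (cross_exp (Suc k) u) (alive_mgf k (l * u) * mgf u - alive_mgf (Suc k) u)"
  unfolding cross_exp_Suc[abs_def] using u
  by (intro has_bochner_integral_diff alive_exp_step) (auto simp: has_bochner_integral_iff alive_mgf_def alive_exp_integrable)

lemma alive_mgf_at_0: "alive_mgf k 0 = prob {\<omega> \<in> space M. enat k < \<tau> \<omega>}"
proof -
  have "alive_mgf k 0 = (\<integral>\<omega>. indicator {\<omega> \<in> space M. enat k < \<tau> \<omega>} \<omega> \<partial>M)"
    unfolding alive_mgf_def by (intro Bochner_Integration.integral_cong)
      (auto simp: alive_exp_def enat_less_first_passage_iff)
  then show ?thesis by simp
qed

lemma expected_time_eq: "expected_time M \<tau> = ennreal (\<Sum>k. alive_mgf k 0)"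
  and alive_mgf_at_0_summable: "summable (\<lambda>k. alive_mgf k 0)"
proof -
  have eq: "expected_time M \<tau> = (\<Sum>k. ennreal (alive_mgf k 0))"
    unfolding expected_time_def nn_integral_enat_function[OF tau_measurable] alive_mgf_at_0
    by (simp add: emeasure_eq_measure)
  then have "(\<Sum>k. ennreal (alive_mgf k 0)) \<noteq> \<top>" using finite_mean by auto
  then show s: "summable (\<lambda>k. alive_mgf k 0)"
    using alive_mgf_nonneg by (intro summable_suminf_not_top) auto
  show eq2: "expected_time M \<tau> = ennreal (\<Sum>k. alive_mgf k 0)"
    unfolding eq using s alive_mgf_nonneg by (intro suminf_ennreal2) auto
qed

lemma tau_finite: "AE \<omega> in M. \<tau> \<omega> \<noteq> \<infinity>"
proof -
  have "AE \<omega> in M. ennreal_of_enat (\<tau> \<omega>) \<noteq> \<infinity>"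
    using finite_mean unfolding expected_time_def by (intro nn_integral_noteq_infinite) auto
  then show ?thesis by eventually_elim (metis ennreal_of_enat_infty infinity_ennreal_def)
qed

lemma alive_mgf_summable: "0 \<le> u \<Longrightarrow> summable (\<lambda>k. alive_mgf k u)"
  by (rule summable_comparison_test'[of "\<lambda>k. exp (u * a) * alive_mgf k 0" 0])
     (auto simp: alive_mgf_nonneg alive_mgf_le intro: summable_mult alive_mgf_at_0_summable)

text \<open>
  The moment generating function of the occupation measure \<open>B \<mapsto> E (card {k. k < \<tau> \<and> X k \<in> B})\<close>, whose
  total mass is \<open>E \<tau>\<close>.
\<close>
definition occ_mgf :: "real \<Rightarrow> real" where
  "occ_mgf u = (\<Sum>k. alive_mgf k u)"

lemma occ_mgf_measurable [measurable]: "occ_mgf \<in> borel_measurable borel"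
  unfolding occ_mgf_def by measurable

lemma occ_mgf_nonneg: "0 \<le> occ_mgf u" if "0 \<le> u"
  unfolding occ_mgf_def by (intro suminf_nonneg alive_mgf_summable alive_mgf_nonneg that)

lemma occ_mgf_le:
  assumes u: "0 \<le> u"
  shows "occ_mgf u \<le> exp (u * a) * occ_mgf 0"
proof -
  have "occ_mgf u \<le> (\<Sum>k. exp (u * a) * alive_mgf k 0)"
    unfolding occ_mgf_def by (intro suminf_le alive_mgf_le alive_mgf_summable summable_mult alive_mgf_at_0_summable u)
  also have "\<dots> = exp (u * a) * occ_mgf 0"
    unfolding occ_mgf_def by (intro suminf_mult alive_mgf_at_0_summable)
  finally show ?thesis .
qed

lemma value_at_tau_measurable [measurable]: "value_at X \<tau> \<in> borel_measurable M"
  unfolding value_at_def[abs_def] by measurable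

lemma exp_value_at_sums:
  assumes "\<tau> \<omega> \<noteq> \<infinity>"
  shows "(\<lambda>k. cross_exp k u \<omega>) sums exp (u * value_at X \<tau> \<omega>)"
proof -
  obtain n where n: "\<tau> \<omega> = enat n" using assms by auto
  have eq: "cross_exp k u \<omega> = (if k = n then exp (u * value_at X \<tau> \<omega>) else 0)" for k
    using n first_passage_eq_enat_iff[of X a \<omega> k] by (auto simp: cross_exp_def value_at_def)
  show ?thesis unfolding eq by (rule sums_single)
qed

text \<open>
  The balance identity.  Each term of \<open>E exp (u * X \<tau>) = (\<Sum>k. E (exp (u * X k); \<tau> = k))\<close> is a difference
  of consecutive contributions to the occupation measure, and \<open>\<tau> = 0\<close> is impossible.
\<close>
lemma exp_value_at_expectation:
  assumes u: "0 \<le> u"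
  shows "has_bochner_integral M (\<lambda>\<omega>. exp (u * value_at X \<tau> \<omega>)) (exp (u * x) + mgf u * occ_mgf (l * u) - occ_mgf u)"
proof -
  define c where "c k = (\<integral>\<omega>. cross_exp k u \<omega> \<partial>M)" for k
  have lu: "0 \<le> l * u" using l u by simp
  have c0: "c 0 = 0" by (simp add: c_def cross_exp_0)
  have cS: "c (Suc k) = mgf u * alive_mgf k (l * u) - alive_mgf (Suc k) u" for k
    using cross_exp_expectation_Suc[OF u, of k] by (simp add: c_def has_bochner_integral_iff mult.commute)
  have int: "integrable M (cross_exp k u)" for k
  proof (cases k)
    case 0
    then show ?thesis by (simp add: cross_exp_0[abs_def] fun_eq_iff)
  next
    case (Suc j)
    then show ?thesis using cross_exp_expectation_Suc[OF u, of j] by (simp add: has_bochner_integral_iff)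
  qed
  have "(\<lambda>k. alive_mgf k u) sums occ_mgf u"
    unfolding occ_mgf_def by (intro summable_sums alive_mgf_summable u)
  then have "(\<lambda>k. alive_mgf (Suc k) u) sums (occ_mgf u - exp (u * x))"
    by (subst sums_Suc_iff) (simp add: alive_mgf_0)
  moreover have "(\<lambda>k. mgf u * alive_mgf k (l * u)) sums (mgf u * occ_mgf (l * u))"
    unfolding occ_mgf_def by (intro sums_mult summable_sums alive_mgf_summable lu)
  ultimately have "(\<lambda>k. c (Suc k)) sums (mgf u * occ_mgf (l * u) - (occ_mgf u - exp (u * x)))"
    unfolding cS by (intro sums_diff)
  then have csums: "c sums (exp (u * x) + mgf u * occ_mgf (l * u) - occ_mgf u)"
    using c0 by (subst (asm) sums_Suc_iff) (simp add: algebra_simps)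
  have nc: "(\<lambda>k. \<integral>\<omega>. norm (cross_exp k u \<omega>) \<partial>M) = c"
    by (auto simp: c_def cross_exp_nonneg fun_eq_iff)
  have AEs: "AE \<omega> in M. summable (\<lambda>k. norm (cross_exp k u \<omega>))"
    using tau_finite
  proof eventually_elim
    case (elim \<omega>)
    show ?case using sums_summable[OF exp_value_at_sums[OF elim, of u]] by (simp add: cross_exp_nonneg)
  qed
  have sc: "summable (\<lambda>k. \<integral>\<omega>. norm (cross_exp k u \<omega>) \<partial>M)"
    unfolding nc using csums by (rule sums_summable)
  have "has_bochner_integral M (\<lambda>\<omega>. \<Sum>k. cross_exp k u \<omega>) (\<Sum>k. c k)"
    using integrable_suminf[OF int AEs sc] integral_suminf[OF int AEs sc]
    by (simp add: has_bochner_integral_iff c_def)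
  also have "(\<Sum>k. c k) = exp (u * x) + mgf u * occ_mgf (l * u) - occ_mgf u"
    using csums by (rule sums_unique[symmetric])
  finally show ?thesis
  proof (rule has_bochner_integral_cong_AE[THEN iffD1, rotated -1])
    show "AE \<omega> in M. (\<Sum>k. cross_exp k u \<omega>) = exp (u * value_at X \<tau> \<omega>)"
      using tau_finite by eventually_elim (rule sums_unique[symmetric, OF exp_value_at_sums])
  qed measurable
qed

lemma value_at_tau_gt: "AE \<omega> in M. a < value_at X \<tau> \<omega>"
  using tau_finite
proof eventually_elim
  case (elim \<omega>)
  then obtain n where "\<tau> \<omega> = enat n" by auto
  then show ?case using first_passage_eq_enat_iff[of X a \<omega> n] by (simp add: value_at_def)
qed

lemma exp_start_le:
  assumes u: "0 \<le> u"
  shows "exp (u * x) \<le> (\<integral>\<omega>. exp (u * value_at X \<tau> \<omega>) \<partial>M)"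
proof -
  have "(\<integral>\<omega>. exp (u * x) \<partial>M) \<le> (\<integral>\<omega>. exp (u * value_at X \<tau> \<omega>) \<partial>M)"
  proof (rule integral_mono_AE)
    show "AE \<omega> in M. exp (u * x) \<le> exp (u * value_at X \<tau> \<omega>)"
      using value_at_tau_gt by eventually_elim (use u start in \<open>auto intro: mult_left_mono\<close>)
  qed (use exp_value_at_expectation[OF u] in \<open>auto simp: has_bochner_integral_iff\<close>)
  then show ?thesis by (simp add: prob_space)
qed

lemma alive_mgf_tendsto: "(alive_mgf k \<longlongrightarrow> alive_mgf k 0) (at_right 0)"
proof (rule tendsto_at_right_sequentially[of 0 1])
  fix s :: "nat \<Rightarrow> real"
  assume s: "\<And>n. 0 < s n" "\<And>n. s n < 1" "s \<longlonglongrightarrow> 0"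
  show "(\<lambda>n. alive_mgf k (s n)) \<longlonglongrightarrow> alive_mgf k 0"
    unfolding alive_mgf_def
  proof (rule integral_dominated_convergence[where w="\<lambda>_. exp \<bar>a\<bar>"])
    show "AE \<omega> in M. (\<lambda>n. alive_exp k (s n) \<omega>) \<longlonglongrightarrow> alive_exp k 0 \<omega>"
      unfolding alive_exp_def by (intro AE_I2 tendsto_intros s)
    show "AE \<omega> in M. norm (alive_exp k (s n) \<omega>) \<le> exp \<bar>a\<bar>" for n
    proof (rule AE_I2)
      fix \<omega>
      have "s n * X k \<omega> \<le> \<bar>a\<bar>" if "X k \<omega> \<le> a"
      proof -
        have "s n * X k \<omega> \<le> s n * \<bar>a\<bar>" using that s(1)[of n] by (intro mult_left_mono) auto
        also have "\<dots> \<le> \<bar>a\<bar>" using s(1,2)[of n] by (intro mult_left_le_one_le) auto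
        finally show ?thesis .
      qed
      then show "norm (alive_exp k (s n) \<omega>) \<le> exp \<bar>a\<bar>" by (auto simp: alive_exp_def)
    qed
  qed auto
qed simp

lemma occ_mgf_tendsto: "(occ_mgf \<longlongrightarrow> occ_mgf 0) (at_right 0)"
proof -
  have ev: "\<forall>\<^sub>F u in at_right 0. (0::real) < u \<and> u < 1"
    by (auto simp: eventually_at_right_field intro: exI[of _ 1])
  have "((\<lambda>u. suminf (\<lambda>k. alive_mgf k u)) \<longlongrightarrow> suminf (\<lambda>k. alive_mgf k 0)) (at_right 0)"
  proof (rule tannerys_theorem[THEN conjunct2, THEN conjunct2])
    show "summable (\<lambda>k. exp \<bar>a\<bar> * alive_mgf k 0)" by (intro summable_mult alive_mgf_at_0_summable)
    show "\<forall>\<^sub>F (k, u) in at_top \<times>\<^sub>F at_right 0. norm (alive_mgf k u) \<le> exp \<bar>a\<bar> * alive_mgf k 0"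
    proof (rule eventually_mono[OF eventually_prodI[OF always_eventually[of "\<lambda>_. True"] ev]])
      fix p :: "nat \<times> real"
      assume "True \<and> 0 < snd p \<and> snd p < 1"
      then have u: "0 < snd p" "snd p < 1" by auto
      have "snd p * a \<le> \<bar>a\<bar>"
      proof -
        have "snd p * a \<le> snd p * \<bar>a\<bar>" using u by (intro mult_left_mono) auto
        also have "\<dots> \<le> \<bar>a\<bar>" using u by (intro mult_left_le_one_le) auto
        finally show ?thesis .
      qed
      then have "exp (snd p * a) * alive_mgf (fst p) 0 \<le> exp \<bar>a\<bar> * alive_mgf (fst p) 0"
        by (intro mult_right_mono alive_mgf_nonneg) simp
      with alive_mgf_le[of "snd p" "fst p"] u alive_mgf_nonneg[of "fst p" "snd p"]
      show "case p of (k, u) \<Rightarrow> norm (alive_mgf k u) \<le> exp \<bar>a\<bar> * alive_mgf k 0"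
        by (simp add: case_prod_beta)
    qed simp
  qed (auto intro: alive_mgf_tendsto)
  then show ?thesis by (simp add: occ_mgf_def[abs_def])
qed

section \<open>The Frullani integrand\<close>

text \<open>
  The damping factor \<open>exp (- \<phi> u)\<close> absorbs \<open>mgf u\<close> in the balance identity, at the price of replacing
  \<open>u\<close> by \<open>l * u\<close>.
\<close>
definition damped_mgf :: "real \<Rightarrow> real" where
  "damped_mgf u = exp (- \<phi> u) * occ_mgf u"

lemma damped_mgf_measurable [measurable]: "damped_mgf \<in> borel_measurable borel"
  unfolding damped_mgf_def by measurable

lemma damped_mgf_tendsto: "(damped_mgf \<longlongrightarrow> occ_mgf 0) (at_right 0)"
proof -
  have "((\<lambda>u. exp (- \<phi> u) * occ_mgf u) \<longlongrightarrow> exp (- 0) * occ_mgf 0) (at_right 0)"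
    by (intro tendsto_intros cumulant_series_tendsto_0 occ_mgf_tendsto)
  then show ?thesis by (simp add: damped_mgf_def[abs_def])
qed

lemma damped_mgf_diff:
  assumes u: "0 \<le> u"
  shows "((\<integral>\<omega>. exp (u * value_at X \<tau> \<omega>) \<partial>M) - exp (u * x)) * exp (- \<phi> u) = damped_mgf (l * u) - damped_mgf u"
proof -
  have "((\<integral>\<omega>. exp (u * value_at X \<tau> \<omega>) \<partial>M) - exp (u * x)) * exp (- \<phi> u)
      = exp (- \<phi> u) * mgf u * occ_mgf (l * u) - exp (- \<phi> u) * occ_mgf u"
    unfolding has_bochner_integral_integral_eq[OF exp_value_at_expectation[OF u]] by algebra
  then show ?thesis unfolding exp_neg_cumulant_series_step[OF u] damped_mgf_def .
qed

text \<open>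
  Near infinity \<open>exp (u * a)\<close> is bounded by \<open>exp (u * y)\<close>, where the integrability at \<open>y\<close> applies; on
  \<open>{e..1}\<close> the integrand is bounded.
\<close>
lemma damped_mgf_integrable:
  assumes y: "a < y" and int: "set_integrable lborel {1..} (\<lambda>u. exp (u * y - \<phi> u) / u)"
    and e: "0 < e"
  shows "integrable lborel (\<lambda>u. indicator {e..} u * (damped_mgf u / u))"
proof -
  obtain B where B: "\<And>u. 0 \<le> u \<Longrightarrow> u \<le> 1 \<Longrightarrow> \<bar>\<phi> u\<bar> \<le> B"
    by (rule cumulant_series_bounded[of 1]) blast
  define C where "C = exp B * (exp \<bar>a\<bar> * occ_mgf 0) / e"
  let ?g = "\<lambda>u. occ_mgf 0 * (indicator {1..} u * (exp (u * y - \<phi> u) / u)) + C * indicator {e..1} u"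
  have S0: "0 \<le> occ_mgf 0" by (rule occ_mgf_nonneg) simp
  have C0: "0 \<le> C" using S0 e by (simp add: C_def)
  have "integrable lborel ?g"
  proof (intro Bochner_Integration.integrable_add integrable_mult_right)
    show "integrable lborel (\<lambda>u. indicator {1..} u * (exp (u * y - \<phi> u) / u))"
      using int by (simp add: set_integrable_def)
    show "integrable lborel (\<lambda>u. indicat_real {e..1} u)"
      by (intro integrable_real_indicator) (auto simp: emeasure_lborel_Icc_eq)
  qed
  then show ?thesis
  proof (rule Bochner_Integration.integrable_bound)
    show "(\<lambda>u. indicator {e..} u * (damped_mgf u / u)) \<in> borel_measurable lborel" by measurable
    have le: "norm (indicator {e..} u * (damped_mgf u / u)) \<le> ?g u" for u
    proof (cases "e \<le> u")
      case True
      then have u: "0 < u" using e by simp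
      have A0: "0 \<le> damped_mgf u" using occ_mgf_nonneg[of u] u by (simp add: damped_mgf_def)
      show ?thesis
      proof (cases "1 \<le> u")
        case u1: True
        have "damped_mgf u \<le> exp (- \<phi> u) * (exp (u * a) * occ_mgf 0)"
          unfolding damped_mgf_def using occ_mgf_le[of u] u by (intro mult_left_mono) auto
        also have "\<dots> \<le> exp (- \<phi> u) * (exp (u * y) * occ_mgf 0)"
          using u y S0 by (intro mult_left_mono mult_right_mono) auto
        also have "\<dots> = occ_mgf 0 * exp (u * y - \<phi> u)"
          by (simp add: exp_diff exp_minus field_simps)
        finally have "damped_mgf u / u \<le> occ_mgf 0 * exp (u * y - \<phi> u) / u"
          using u by (intro divide_right_mono) auto
        then show ?thesis using True u1 A0 u C0 by (auto simp: indicator_def)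
      next
        case u1: False
        have "u * a \<le> u * \<bar>a\<bar>" using u by (intro mult_left_mono) auto
        also have "\<dots> \<le> \<bar>a\<bar>" using u u1 by (intro mult_left_le_one_le) auto
        finally have ua: "exp (u * a) \<le> exp \<bar>a\<bar>" by simp
        have "damped_mgf u \<le> exp (- \<phi> u) * (exp (u * a) * occ_mgf 0)"
          unfolding damped_mgf_def using occ_mgf_le[of u] u by (intro mult_left_mono) auto
        also have "\<dots> \<le> exp B * (exp \<bar>a\<bar> * occ_mgf 0)"
          using B[of u] u u1 ua S0 by (intro mult_mono) auto
        finally have "damped_mgf u / u \<le> exp B * (exp \<bar>a\<bar> * occ_mgf 0) / u"
          using u by (intro divide_right_mono) auto
        also have "\<dots> \<le> C" unfolding C_def using True e S0 by (intro divide_left_mono) auto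
        finally show ?thesis using True u1 A0 u by (simp add: indicator_def)
      qed
    next
      case False
      then have "0 \<le> ?g u" using S0 C0 by (auto simp: indicator_def)
      then show ?thesis using False by simp
    qed
    show "AE u in lborel. norm (indicator {e..} u * (damped_mgf u / u)) \<le> norm (?g u)"
      unfolding real_norm_def[of "?g _"] by (intro AE_I2 order_trans[OF le abs_ge_self])
  qed
qed

text \<open>The value \<open>X \<tau>\<close> on a sample path with finite passage time is such a state.\<close>
lemma state_above_level:
  assumes D: "\<And>n. AE \<omega> in M. X n \<omega> \<in> D"
  obtains y where "y \<in> D" "a < y"
proof -
  have "AE \<omega> in M. (\<forall>n. X n \<omega> \<in> D) \<and> \<tau> \<omega> \<noteq> \<infinity>"
    using D tau_finite by (simp add: AE_all_countable)
  then have "\<exists>\<omega>. (\<forall>n. X n \<omega> \<in> D) \<and> \<tau> \<omega> \<noteq> \<infinity>"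
  proof (rule contrapos_pp)
    assume "\<not> (\<exists>\<omega>. (\<forall>n. X n \<omega> \<in> D) \<and> \<tau> \<omega> \<noteq> \<infinity>)"
    then show "\<not> (AE \<omega> in M. (\<forall>n. X n \<omega> \<in> D) \<and> \<tau> \<omega> \<noteq> \<infinity>)"
      by (simp only: not_ex) simp
  qed
  then obtain \<omega> n where "\<forall>n. X n \<omega> \<in> D" "\<tau> \<omega> = enat n" by auto
  then show thesis using first_passage_eq_enat_iff[of X a \<omega> n] that[of "X n \<omega>"] by auto
qed

end

theorem theorem3:
  fixes M :: "'a measure"
    and \<eta> :: "nat \<Rightarrow> 'a \<Rightarrow> real"
    and l x a :: real
    and D :: "real set"
  defines "X \<equiv> ar1 l x \<eta>"
    and "\<phi> \<equiv> cumulant_series M l (\<eta> 1)"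
    and "\<tau> \<equiv> first_passage (ar1 l x \<eta>) a"
  assumes "prob_space M"
    and "iid_seq M \<eta>"
    and "0 < l" and "l < 1"
    and "x \<le> a"
    and "x \<in> D"
    and "\<And>n. AE \<omega> in M. X n \<omega> \<in> D"
    and "\<And>u. 0 \<le> u \<Longrightarrow> integrable M (\<lambda>\<omega>. exp (u * \<eta> 1 \<omega>))"
    and "integrable M (\<lambda>\<omega>. ln (1 + \<bar>\<eta> 1 \<omega>\<bar>))"
    and "\<And>y. y \<in> D \<Longrightarrow> set_integrable lborel {1..} (\<lambda>u. exp (u * y - \<phi> u) / u)"
    and "expected_time M \<tau> < \<infinity>"
  shows "(\<forall>u\<ge>0. integrable M (\<lambda>\<omega>. exp (u * value_at X \<tau> \<omega>))) \<and>
    set_integrable lborel {0<..}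
      (\<lambda>u. ((\<integral>\<omega>. exp (u * value_at X \<tau> \<omega>) \<partial>M) - exp (u * x)) * exp (- \<phi> u) / u) \<and>
    expected_time M \<tau> = ennreal (1 / ln (1 / l) *
      (LBINT u:{0<..}.
         ((\<integral>\<omega>. exp (u * value_at X \<tau> \<omega>) \<partial>M) - exp (u * x)) * exp (- \<phi> u) / u))"
proof -
  have meas: "\<eta> 1 \<in> borel_measurable M"
    using assms(4,5) by (auto simp: iid_seq_def prob_space.indep_vars_def)
  have "ar1_innovation M (\<eta> 1) l"
    by (intro ar1_innovation.intro ar1_innovation_axioms.intro; fact assms meas)
  moreover have "ar1_passage_axioms M \<eta> l x a"
    using assms(5,8,14) unfolding \<tau>_def by (rule ar1_passage_axioms.intro)
  ultimately interpret P: ar1_passage M \<eta> l x a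
    by (rule ar1_passage.intro)
  let ?G = "\<lambda>u. ((\<integral>\<omega>. exp (u * value_at X \<tau> \<omega>) \<partial>M) - exp (u * x)) * exp (- \<phi> u) / u"
  obtain y where y: "y \<in> D" "a < y"
    by (rule P.state_above_level[of D]) (use assms(10) in \<open>simp add: X_def\<close>)
  have int: "set_integrable lborel {1..} (\<lambda>u. exp (u * y - P.\<phi> u) / u)"
    using assms(13)[OF y(1)] by (simp add: \<phi>_def)
  have diff: "?G u = (P.damped_mgf (l * u) - P.damped_mgf u) / u" if "0 < u" for u
    using P.damped_mgf_diff[of u] that by (simp add: X_def \<tau>_def \<phi>_def)
  have nonneg: "P.damped_mgf u \<le> P.damped_mgf (l * u)" if u: "0 < u" for u
  proof -
    have "0 \<le> ((\<integral>\<omega>. exp (u * value_at P.X P.\<tau> \<omega>) \<partial>M) - exp (u * x)) * exp (- P.\<phi> u)"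
      using P.exp_start_le[of u] u by simp
    then show ?thesis using P.damped_mgf_diff[of u] u by simp
  qed
  have "has_bochner_integral lborel (\<lambda>u. indicator {0<..} u * ((P.damped_mgf (l * u) - P.damped_mgf u) / u)) (P.occ_mgf 0 * ln (1 / l))"
    using P.l by (intro frullani_nonneg P.damped_mgf_measurable P.damped_mgf_integrable[OF y(2) int] P.damped_mgf_tendsto nonneg)
  also have "(\<lambda>u. indicator {0<..} u * ((P.damped_mgf (l * u) - P.damped_mgf u) / u)) = (\<lambda>u. indicator {0<..} u * ?G u)"
    using diff by (auto simp: fun_eq_iff indicator_def)
  finally have G: "set_integrable lborel {0<..} ?G" "(LBINT u:{0<..}. ?G u) = P.occ_mgf 0 * ln (1 / l)"
    by (simp_all add: has_bochner_integral_iff set_integrable_def set_lebesgue_integral_def)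
  have "0 < ln (1 / l)" using P.l by simp
  then have "expected_time M \<tau> = ennreal (1 / ln (1 / l) * (LBINT u:{0<..}. ?G u))"
    unfolding G(2) using P.expected_time_eq by (simp add: \<tau>_def P.occ_mgf_def)
  moreover have "\<forall>u\<ge>0. integrable M (\<lambda>\<omega>. exp (u * value_at X \<tau> \<omega>))"
    using P.exp_value_at_expectation by (auto simp: X_def \<tau>_def has_bochner_integral_iff)
  ultimately show ?thesis using G(1) by blast
qed

end
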